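(* Let $X\subseteq\mathbb{Z}^2\setminus\{O\}$ be an arbitrary step set. (i) If $X$ is empty, then $\mathcal{A}_X$ is a trivial group. (ii) If $X$ is non-empty, and is contained in a line $\mathscr{L}$ through the origin, then $\mathcal{A}_X$ is a group if and only if $X$ contains points from $\mathscr{L}$ on both sides of the origin; in this case, $\mathcal{A}_X$ is isomorphic to $(\mathbb{Z},+)$. (iii) If $X$ is not contained in any line through the origin, then $\mathcal{A}_X$ is a group if and only if $X$ does not satisfy the Weak Line Condition (WLC); in this case, $\mathcal{A}_X$ is isomorphic to $(\mathbb{Z}^2,+)$.
   Context: Write $O=(0,0)$ for the origin. A step set is any (finite or infinite) subset $X$ of $\mathbb{Z}^2\setminus\{O\}$. $\mathcal{A}_X$ is the additive submonoid of $\mathbb{Z}^2$ generated by $X$ (with identity $O$). $X$ satisfies the WLC if it is contained in the closure of a half-plane determined by a line through the origin, i.e. in a closed half-plane of $\mathbb{R}^2$ whose bounding line passes through $O$. *)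

theory Defs
  imports "HOL-Analysis.Analysis" "HOL-Algebra.Elementary_Groups"
begin

abbreviation Z2_group :: "(int \<times> int) monoid"
  where "Z2_group \<equiv> integer_group \<times>\<times> integer_group"

definition step_set :: "(int \<times> int) set \<Rightarrow> bool"
  where "step_set X \<longleftrightarrow> (0, 0) \<notin> X"

(* As a monoid record, so that group, trivial_group and \<cong> apply to it directly;
   the carrier is the intersection of all submonoids of Z^2 containing X. *)
definition step_monoid :: "(int \<times> int) set \<Rightarrow> (int \<times> int) monoid"
  where "step_monoid X = Z2_group\<lparr>carrier := (\<lambda>M. submonoid M Z2_group) hull X\<rparr>"

fun plane_point :: "int \<times> int \<Rightarrow> real \<times> real"
  where "plane_point (a, b) = (real_of_int a, real_of_int b)"

definition line_through_origin :: "(real \<times> real) set \<Rightarrow> bool"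
  where "line_through_origin L \<longleftrightarrow> subspace L \<and> dim L = 1"

(* For points p, q on a line through 0, being on different sides of 0 means that
   0 lies strictly between them. *)
definition both_sides_of_origin :: "(int \<times> int) set \<Rightarrow> (real \<times> real) set \<Rightarrow> bool"
  where "both_sides_of_origin X L \<longleftrightarrow>
    (\<exists>p \<in> plane_point ` X \<inter> L. \<exists>q \<in> plane_point ` X \<inter> L. 0 \<in> open_segment p q)"

(* Weak Line Condition.  The set {z. a \<bullet> z > 0} is an open half-plane determined by the
   line {z. a \<bullet> z = 0}; the opposite half-plane is obtained from -a. *)
definition WLC :: "(int \<times> int) set \<Rightarrow> bool"
  where "WLC X \<longleftrightarrow> (\<exists>a::real \<times> real. a \<noteq> 0 \<and> plane_point ` X \<subseteq> closure {z. a \<bullet> z > 0})"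

end

theory Submission
  imports Defs
begin

text \<open>The group question is whether every step has its negative in the monoid. For a step \<open>z\<close> the
  identity \<open>det(x,y) z + det(y,z) x + det(z,x) y = 0\<close> with \<open>x\<close> strictly left and \<open>y\<close> strictly right
  of \<open>z\<close> yields \<open>-z\<close> as soon as \<open>det(x,y) > 0\<close>. If no such pair exists, the cotangents of the angles
  from \<open>z\<close> to the left steps lie above the negated cotangents for the right steps; the infimum of the
  former separates the two and gives a closed half-plane containing all steps.\<close>

abbreviation step_sums :: "(int \<times> int) set \<Rightarrow> (int \<times> int) set"
  where "step_sums X \<equiv> carrier (step_monoid X)"

abbreviation zscale :: "int \<Rightarrow> int \<times> int \<Rightarrow> int \<times> int"
  where "zscale k z \<equiv> (k * fst z, k * snd z)"

text \<open>The sign tells the side: positive when \<open>y\<close> is strictly left of the line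
  directed by \<open>x\<close>, zero when the two are collinear. It is integer-valued so that
  determinants can serve as multiplicities of steps.\<close>

definition zdet :: "int \<times> int \<Rightarrow> int \<times> int \<Rightarrow> int"
  where "zdet x y = fst x * snd y - snd x * fst y"

definition zdot :: "int \<times> int \<Rightarrow> int \<times> int \<Rightarrow> int"
  where "zdot x y = fst x * fst y + snd x * snd y"

lemma zdot_self_pos: "z \<noteq> 0 \<Longrightarrow> zdot z z > 0"
  by (cases z) (auto simp: zdot_def zero_prod_def sum_squares_gt_zero_iff)

section \<open>The step monoid\<close>

text \<open>Replaces the record operations of \<open>Z2_group\<close> by the additive structure on
  pairs, so that everything below is plain integer arithmetic.\<close>

lemma submonoid_Z2_iff:
  "submonoid M Z2_group \<longleftrightarrow> 0 \<in> M \<and> (\<forall>x\<in>M. \<forall>y\<in>M. x + y \<in> M)"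
proof -
  have "x \<otimes>\<^bsub>Z2_group\<^esub> y = x + y" for x y
    by (simp add: DirProd_def integer_group_def plus_prod_def case_prod_beta)
  moreover have "\<one>\<^bsub>Z2_group\<^esub> = 0" "carrier Z2_group = UNIV"
    by (simp_all add: zero_prod_def)
  ultimately show ?thesis
    unfolding submonoid_def by (simp only: subset_UNIV simp_thms) blast
qed

lemma step_sums_hull:
  "step_sums X = (\<lambda>M. 0 \<in> M \<and> (\<forall>x\<in>M. \<forall>y\<in>M. x + y \<in> M)) hull X"
  by (simp add: step_monoid_def submonoid_Z2_iff)

lemma step_monoid_simps [simp]:
  "x \<otimes>\<^bsub>step_monoid X\<^esub> y = x + y"
  "\<one>\<^bsub>step_monoid X\<^esub> = 0"
  by (auto simp: step_monoid_def DirProd_def integer_group_def zero_prod_def plus_prod_def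
      case_prod_beta)

lemma zero_in_step_sums: "0 \<in> step_sums X"
  by (auto simp: step_sums_hull hull_def)

lemma add_in_step_sums: "x \<in> step_sums X \<Longrightarrow> y \<in> step_sums X \<Longrightarrow> x + y \<in> step_sums X"
  by (auto simp: step_sums_hull hull_def)

lemma step_in_step_sums: "x \<in> X \<Longrightarrow> x \<in> step_sums X"
  by (auto simp: step_sums_hull hull_def)

text \<open>Minimality of the hull: \<open>Collect P\<close> is itself a submonoid containing
  \<open>X\<close>.\<close>

lemma step_sums_induct [consumes 1, case_names zero step add]:
  assumes "z \<in> step_sums X" "P 0" "\<And>x. x \<in> X \<Longrightarrow> P x"
    "\<And>x y. P x \<Longrightarrow> P y \<Longrightarrow> P (x + y)"
  shows "P z"
proof -
  have "step_sums X \<subseteq> Collect P"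
    unfolding step_sums_hull by (rule hull_minimal) (use assms in auto)
  then show ?thesis using assms(1) by auto
qed

lemma zscale_in_step_sums:
  assumes "z \<in> step_sums X" "k \<ge> 0"
  shows "zscale k z \<in> step_sums X"
  using assms(2)
proof (induction k rule: int_ge_induct)
  case base
  then show ?case using zero_in_step_sums by (simp add: zero_prod_def)
next
  case (step i)
  have "zscale (i + 1) z = zscale i z + z"
    by (simp add: prod_eq_iff algebra_simps)
  then show ?case using step assms(1) add_in_step_sums by simp
qed

text \<open>A vanishing sum that uses \<open>z\<close> at least once yields an inverse: removing one
  copy of \<open>z\<close> leaves \<open>-z\<close>. Every inverse of a step below arises from such
  a relation.\<close>

lemma uminus_in_step_sums:
  assumes "z \<in> step_sums X" "w \<in> step_sums X" "k > 0" "zscale k z + w = 0"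
  shows "- z \<in> step_sums X"
proof -
  have "- z = zscale (k - 1) z + w"
    using assms(4) by (simp add: prod_eq_iff algebra_simps)
  then show ?thesis
    using zscale_in_step_sums[of z X "k - 1"] assms add_in_step_sums by simp
qed

lemma group_step_monoidD:
  assumes "group (step_monoid X)" "x \<in> step_sums X"
  shows "- x \<in> step_sums X"
proof -
  obtain y where "y \<in> step_sums X" "y \<otimes>\<^bsub>step_monoid X\<^esub> x = \<one>\<^bsub>step_monoid X\<^esub>"
    using group.l_inv_ex[OF assms] by blast
  then show ?thesis by (simp add: add_eq_0_iff2)
qed

text \<open>Inverses of the generators suffice, because in a commutative monoid the invertible
  elements are closed under addition.\<close>

lemma group_step_monoid_iff: "group (step_monoid X) \<longleftrightarrow> (\<forall>x\<in>X. - x \<in> step_sums X)"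
proof
  assume "group (step_monoid X)"
  then show "\<forall>x\<in>X. - x \<in> step_sums X"
    using group_step_monoidD step_in_step_sums by blast
next
  assume neg: "\<forall>x\<in>X. - x \<in> step_sums X"
  have inv: "- x \<in> step_sums X" if "x \<in> step_sums X" for x
    using that
  proof (induction rule: step_sums_induct)
    case zero
    then show ?case using zero_in_step_sums by simp
  next
    case (add x y)
    then show ?case using add_in_step_sums[of "- x" X "- y"] by (simp add: add.commute)
  qed (use neg in auto)
  show "group (step_monoid X)"
  proof (rule groupI)
    fix x assume "x \<in> step_sums X"
    then show "\<exists>y\<in>step_sums X. y \<otimes>\<^bsub>step_monoid X\<^esub> x = \<one>\<^bsub>step_monoid X\<^esub>"
      using inv by (intro bexI[of _ "- x"]) auto
  qed (auto simp: zero_in_step_sums add_in_step_sums add.assoc)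
qed

lemma zscale_in_step_group:
  assumes "group (step_monoid X)" "z \<in> step_sums X"
  shows "zscale k z \<in> step_sums X"
proof (cases "k \<ge> 0")
  case False
  then show ?thesis
    using zscale_in_step_sums[of "- z" X "- k"] group_step_monoidD[OF assms] by simp
qed (use zscale_in_step_sums assms in auto)

lemma trivial_group_step_monoid_empty: "trivial_group (step_monoid {})"
proof -
  have "z = 0" if "z \<in> step_sums {}" for z
    using that by (induction rule: step_sums_induct) auto
  then have "step_sums {} = {0}" using zero_in_step_sums by blast
  then show ?thesis
    using group_step_monoid_iff[of "{}"] by (simp add: trivial_group_def)
qed

section \<open>Lines and half-planes in integer coordinates\<close>

lemma inner_plane_point: "a \<bullet> plane_point z = fst a * fst z + snd a * snd z"
  by (cases z; cases a) simp

lemma hyperplane_line: "a \<noteq> 0 \<Longrightarrow> line_through_origin {z. a \<bullet> z = 0}"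
  by (simp add: line_through_origin_def subspace_hyperplane dim_hyperplane)

lemma zdet_on_line:
  assumes "line_through_origin L" "plane_point x \<in> L" "plane_point y \<in> L"
  shows "zdet x y = 0"
proof -
  from assms(1) obtain B where "B \<subseteq> L" "L \<subseteq> span B" "card B = 1"
    using basis_exists[of L] unfolding line_through_origin_def by metis
  then obtain v where "L \<subseteq> span {v}" by (auto simp: card_1_singleton_iff)
  then have "plane_point x \<in> range (\<lambda>k. k *\<^sub>R v)" "plane_point y \<in> range (\<lambda>k. k *\<^sub>R v)"
    using assms(2,3) by (auto simp: span_singleton)
  then obtain s t where "plane_point x = s *\<^sub>R v" "plane_point y = t *\<^sub>R v" by blast
  then have "real_of_int (zdet x y) = 0"
    by (cases x; cases y; cases v) (auto simp: zdet_def)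
  then show ?thesis by simp
qed

text \<open>If all determinants with a fixed step \<open>x\<close> vanished, every step would lie on
  the line spanned by \<open>x\<close>.\<close>

lemma exists_zdet_nonzero:
  assumes "step_set X" "\<not> (\<exists>L. line_through_origin L \<and> plane_point ` X \<subseteq> L)"
  obtains x y where "x \<in> X" "y \<in> X" "zdet x y \<noteq> 0"
proof (cases "X = {}")
  case True
  \<comment> \<open>The empty set lies on every line; \<open>(1, 0)\<close> is just some normal
    vector.\<close>
  then show ?thesis using assms(2) hyperplane_line[of "(1, 0)"] by (auto simp: zero_prod_def)
next
  case False
  then obtain x where x: "x \<in> X" by auto
  then have "x \<noteq> 0" using assms(1) by (auto simp: step_set_def zero_prod_def)
  \<comment> \<open>The quarter turn of \<open>x\<close>, which is normal to the line through
    \<open>x\<close> and turns the inner product into \<open>zdet x\<close>.\<close>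
  define a where "a = (- real_of_int (snd x), real_of_int (fst x))"
  have "a \<noteq> 0" using \<open>x \<noteq> 0\<close> by (auto simp: a_def prod_eq_iff)
  then obtain y where "y \<in> X" "a \<bullet> plane_point y \<noteq> 0"
    using assms(2) hyperplane_line by blast
  moreover have "a \<bullet> plane_point y = real_of_int (zdet x y)"
    by (simp add: inner_plane_point a_def zdet_def)
  ultimately show ?thesis using that x by auto
qed

lemma WLC_iff: "WLC X \<longleftrightarrow> (\<exists>a\<noteq>0. \<forall>x\<in>X. a \<bullet> plane_point x \<ge> 0)"
  unfolding WLC_def by (rule ex_cong1) (auto simp: closure_halfspace_gt)

text \<open>A closed half-plane through the origin is closed under addition. This is the obstruction
  to inverses: a step strictly inside the half-plane has its negative outside.\<close>

lemma inner_step_sums_nonneg: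
  assumes "z \<in> step_sums X" "\<And>x. x \<in> X \<Longrightarrow> a \<bullet> plane_point x \<ge> 0"
  shows "a \<bullet> plane_point z \<ge> 0"
  using assms(1)
proof (induction rule: step_sums_induct)
  case (add x y)
  have "a \<bullet> plane_point (x + y) = a \<bullet> plane_point x + a \<bullet> plane_point y"
    by (simp add: inner_plane_point algebra_simps)
  then show ?case using add by simp
qed (use assms(2) in \<open>auto simp: inner_plane_point\<close>)

lemma inner_plane_point_uminus: "a \<bullet> plane_point (- z) = - (a \<bullet> plane_point z)"
  by (simp add: inner_plane_point)

section \<open>Steps on a line\<close>

text \<open>The difference of the two sides is \<open>zdet x y\<close> times the clockwise quarter
  turn of \<open>x\<close>. When \<open>zdot x y\<close> is negative this is a relation with
  positive coefficients between opposite steps.\<close>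

lemma zscale_zdot_collinear:
  assumes "zdet x y = 0"
  shows "zscale (zdot x y) x = zscale (zdot x x) y"
proof -
  have "zdot x y * fst x - zdot x x * fst y = snd x * zdet x y"
    "zdot x y * snd x - zdot x x * snd y = - (fst x * zdet x y)"
    by (simp_all add: zdot_def zdet_def algebra_simps)
  then show ?thesis using assms by simp
qed

text \<open>On a common line, two nonzero points are on opposite sides of the origin exactly when
  their dot product is negative, a condition on integers only.\<close>

lemma both_sides_iff:
  assumes "step_set X" "line_through_origin L" "plane_point ` X \<subseteq> L"
  shows "both_sides_of_origin X L \<longleftrightarrow> (\<exists>x\<in>X. \<exists>y\<in>X. zdot x y < 0)"
proof
  assume "both_sides_of_origin X L"
  then obtain x y where xy: "x \<in> X" "y \<in> X" "0 \<in> open_segment (plane_point x) (plane_point y)"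
    unfolding both_sides_of_origin_def by blast
  then obtain u where u: "0 < u" "u < 1" "0 = (1 - u) *\<^sub>R plane_point x + u *\<^sub>R plane_point y"
    by (auto simp: in_segment)
  have "x \<noteq> 0" using xy(1) assms(1) by (auto simp: step_set_def zero_prod_def)
  have c: "(1 - u) * fst x + u * fst y = 0" "(1 - u) * snd x + u * snd y = 0"
    using u(3) by (cases x; cases y; simp add: zero_prod_def)+
  \<comment> \<open>Taking the dot product of the convex combination with \<open>x\<close> expresses
    \<open>zdot x y\<close> through the positive \<open>zdot x x\<close>.\<close>
  have "u * zdot x y = fst x * (u * fst y) + snd x * (u * snd y)"
    by (simp add: zdot_def algebra_simps)
  also have "\<dots> = fst x * (- (1 - u) * fst x) + snd x * (- (1 - u) * snd x)"
    using c by (simp only: add_eq_0_iff)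
  also have "\<dots> = - ((1 - u) * zdot x x)"
    by (simp add: zdot_def algebra_simps)
  also have "\<dots> < 0"
    using zdot_self_pos[OF \<open>x \<noteq> 0\<close>] u by simp
  finally have "zdot x y < 0" using u(1) by (simp add: mult_less_0_iff)
  then show "\<exists>x\<in>X. \<exists>y\<in>X. zdot x y < 0" using xy by blast
next
  assume "\<exists>x\<in>X. \<exists>y\<in>X. zdot x y < 0"
  then obtain x y where xy: "x \<in> X" "y \<in> X" "zdot x y < 0" by blast
  have "x \<noteq> 0" using xy(1) assms(1) by (auto simp: step_set_def zero_prod_def)
  have "zdet x y = 0" using zdet_on_line[OF assms(2)] assms(3) xy by blast
  define p where "p = real_of_int (zdot x x)"
  define q where "q = - real_of_int (zdot x y)"
  have pq: "p > 0" "q > 0" using xy(3) zdot_self_pos[OF \<open>x \<noteq> 0\<close>] by (auto simp: p_def q_def)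
  have "q *\<^sub>R plane_point x + p *\<^sub>R plane_point y = 0"
    using zscale_zdot_collinear[OF \<open>zdet x y = 0\<close>] unfolding p_def q_def
    by (cases x; cases y; simp add: zero_prod_def flip: of_int_mult)
  \<comment> \<open>The positive relation is normalised to weights of sum 1.\<close>
  then have "0 = (1 / (p + q)) *\<^sub>R (q *\<^sub>R plane_point x + p *\<^sub>R plane_point y)"
    by simp
  also have "\<dots> = (1 - p / (p + q)) *\<^sub>R plane_point x + (p / (p + q)) *\<^sub>R plane_point y"
    using pq by (simp add: scaleR_add_right field_simps)
  finally have "0 = (1 - p / (p + q)) *\<^sub>R plane_point x + (p / (p + q)) *\<^sub>R plane_point y" .
  moreover have "0 < p / (p + q)" "p / (p + q) < 1" using pq by auto
  \<comment> \<open>An open segment with equal endpoints is empty, so distinctness has to be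
    supplied; for equal points \<open>zdot x y\<close> would be positive.\<close>
  moreover have "plane_point x \<noteq> plane_point y"
    using xy(3) zdot_self_pos[OF \<open>x \<noteq> 0\<close>] by (cases x; cases y) auto
  ultimately have "0 \<in> open_segment (plane_point x) (plane_point y)"
    unfolding in_segment by blast
  then show "both_sides_of_origin X L"
    unfolding both_sides_of_origin_def using xy assms(3) by blast
qed

text \<open>Without a negative dot product, any step \<open>x\<close> is the normal of a closed
  half-plane containing all sums but not \<open>-x\<close>. Conversely, given opposite steps
  \<open>x\<close> and \<open>y\<close>, every step \<open>z\<close> is opposite to one of them, and
  that one supplies \<open>-z\<close>.\<close>

lemma group_collinear_iff:
  assumes "step_set X" "X \<noteq> {}" "\<And>x y. x \<in> X \<Longrightarrow> y \<in> X \<Longrightarrow> zdet x y = 0"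
  shows "group (step_monoid X) \<longleftrightarrow> (\<exists>x\<in>X. \<exists>y\<in>X. zdot x y < 0)"
proof
  assume G: "group (step_monoid X)"
  obtain x where x: "x \<in> X" using assms(2) by auto
  then have "x \<noteq> 0" using assms(1) by (auto simp: step_set_def zero_prod_def)
  have dot: "plane_point x \<bullet> plane_point y = real_of_int (zdot x y)" for y
    by (cases x) (simp add: inner_plane_point zdot_def)
  show "\<exists>x\<in>X. \<exists>y\<in>X. zdot x y < 0"
  proof (rule ccontr)
    assume "\<not> ?thesis"
    then have "plane_point x \<bullet> plane_point y \<ge> 0" if "y \<in> X" for y
      using x that by (simp add: dot not_less)
    then have "plane_point x \<bullet> plane_point (- x) \<ge> 0"
      using G x inner_step_sums_nonneg group_step_monoid_iff by blast
    then show False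
      using zdot_self_pos[OF \<open>x \<noteq> 0\<close>] by (simp add: inner_plane_point_uminus dot)
  qed
next
  assume "\<exists>x\<in>X. \<exists>y\<in>X. zdot x y < 0"
  then obtain x y where xy: "x \<in> X" "y \<in> X" "zdot x y < 0" by blast
  show "group (step_monoid X)"
    unfolding group_step_monoid_iff
  proof
    fix z assume z: "z \<in> X"
    then have "z \<noteq> 0" using assms(1) by (auto simp: step_set_def zero_prod_def)
    have neg: "- z \<in> step_sums X" if "w \<in> X" "zdot z w < 0" for w
    proof (rule uminus_in_step_sums)
      show "zscale (zdot z z) w \<in> step_sums X"
        using that step_in_step_sums zscale_in_step_sums zdot_self_pos[OF \<open>z \<noteq> 0\<close>] by simp
      show "zscale (- zdot z w) z + zscale (zdot z z) w = 0"
        using zscale_zdot_collinear[OF assms(3)[OF z that(1)]] by (simp add: zero_prod_def)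
    qed (use that z step_in_step_sums in auto)
    \<comment> \<open>Binet-Cauchy identity. The determinants vanish on the line, so
      \<open>zdot y z\<close> and \<open>zdot x z\<close> have opposite signs once
      \<open>zdot x z\<close> is nonzero, which the Lagrange identity below provides.\<close>
    have "zdot x x * zdot y z = zdot x z * zdot x y + zdet x y * zdet x z"
      by (simp add: zdot_def zdet_def algebra_simps)
    then have *: "zdot x x * zdot y z = zdot x z * zdot x y"
      using assms(3) xy by simp
    have "x \<noteq> 0" using xy by (auto simp: zdot_def)
    have "zdot x x * zdot z z = zdot x z * zdot x z + zdet x z * zdet x z"
      by (simp add: zdot_def zdet_def algebra_simps)
    then have "zdot x x * zdot z z = zdot x z * zdot x z" using assms(3) xy z by simp
    then have "zdot x z \<noteq> 0"
      using zdot_self_pos[OF \<open>x \<noteq> 0\<close>] zdot_self_pos[OF \<open>z \<noteq> 0\<close>] by auto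
    then consider "zdot x z < 0" | "zdot x z > 0" by linarith
    then show "- z \<in> step_sums X"
    proof cases
      case 1
      then show ?thesis using neg[of x] xy by (simp add: zdot_def mult.commute)
    next
      case 2
      then have "zdot x x * zdot y z < 0"
        using * xy(3) by (simp add: mult_pos_neg)
      then have "zdot y z < 0"
        using zdot_self_pos[OF \<open>x \<noteq> 0\<close>] by (simp add: mult_less_0_iff)
      then show ?thesis using neg[of y] xy by (simp add: zdot_def mult.commute)
    qed
  qed
qed

section \<open>Steps spanning the plane\<close>

text \<open>In a group both \<open>x\<close> and \<open>-x\<close> lie in the half-plane, which
  forces every step onto its boundary line.\<close>

lemma group_imp_not_WLC:
  assumes "group (step_monoid X)" "\<not> (\<exists>L. line_through_origin L \<and> plane_point ` X \<subseteq> L)"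
  shows "\<not> WLC X"
proof
  assume "WLC X"
  then obtain a where a: "a \<noteq> 0" "\<And>x. x \<in> X \<Longrightarrow> a \<bullet> plane_point x \<ge> 0"
    unfolding WLC_iff by blast
  have "a \<bullet> plane_point x = 0" if "x \<in> X" for x
  proof -
    have "a \<bullet> plane_point (- x) \<ge> 0"
      using assms(1) that inner_step_sums_nonneg[OF _ a(2)] group_step_monoid_iff by blast
    then show ?thesis using a(2)[OF that] by (simp add: inner_plane_point_uminus)
  qed
  then show False using assms(2) hyperplane_line[OF a(1)] by blast
qed

text \<open>A single step \<open>z\<close> whose negative is missing is enough to build a normal
  vector \<open>a\<close> witnessing the WLC.\<close>

lemma not_WLC_imp_group:
  assumes "step_set X" "\<not> WLC X"
  shows "group (step_monoid X)"
  unfolding group_step_monoid_iff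
proof (rule ballI, rule ccontr)
  fix z assume z: "z \<in> X" and nz: "- z \<notin> step_sums X"
  have "z \<noteq> 0" using z assms(1) by (auto simp: step_set_def zero_prod_def)
  note zz = zdot_self_pos[OF this]
  \<comment> \<open>Cotangent of the signed angle from \<open>z\<close> to \<open>p\<close>. For
    right steps the denominator is negative, so the negation of the cotangent of the unsigned angle
    is built in.\<close>
  define cot where "cot = (\<lambda>p. real_of_int (zdot z p) / real_of_int (zdet z p))"
  define U where "U = {x \<in> X. zdet z x > 0}"
  \<comment> \<open>Were one side of \<open>z\<close> empty, a quarter turn of \<open>z\<close>
    would already be a normal vector for the WLC. Both sides are needed for the infimum: left steps
    make the set nonempty, a right step bounds it below.\<close>
  have left_ne: "U \<noteq> {}"
  proof
    assume e: "U = {}"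
    define a where "a = (real_of_int (snd z), - real_of_int (fst z))"
    have "a \<noteq> 0" using \<open>z \<noteq> 0\<close> by (auto simp: a_def prod_eq_iff)
    moreover have "a \<bullet> plane_point x \<ge> 0" if "x \<in> X" for x
    proof -
      have "a \<bullet> plane_point x = - real_of_int (zdet z x)"
        by (simp add: inner_plane_point a_def zdet_def)
      moreover have "zdet z x \<le> 0" using e that unfolding U_def by fastforce
      ultimately show ?thesis by simp
    qed
    ultimately show False using assms(2) WLC_iff by blast
  qed
  have right_ne: "\<exists>y\<in>X. zdet z y < 0"
  proof (rule ccontr)
    assume e: "\<not> ?thesis"
    define a where "a = (- real_of_int (snd z), real_of_int (fst z))"
    have "a \<noteq> 0" using \<open>z \<noteq> 0\<close> by (auto simp: a_def prod_eq_iff)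
    moreover have "a \<bullet> plane_point x \<ge> 0" if "x \<in> X" for x
    proof -
      have "a \<bullet> plane_point x = real_of_int (zdet z x)"
        by (simp add: inner_plane_point a_def zdet_def)
      then show ?thesis using e that by force
    qed
    ultimately show False using assms(2) WLC_iff by blast
  qed
  have sep: "cot y \<le> cot x" if "x \<in> U" "y \<in> X" "zdet z y < 0" for x y
  proof -
    have x: "x \<in> X" "zdet z x > 0" using that by (auto simp: U_def)
    have "zdet x y \<le> 0"
    proof (rule ccontr)
      assume neg: "\<not> ?thesis"
      \<comment> \<open>The three-term determinant identity, with \<open>- zdet z y\<close> for
        det(y,z). All coefficients are positive here, so \<open>-z\<close> would be a sum of
        steps.\<close>
      have "zscale (zdet x y) z + (zscale (- zdet z y) x + zscale (zdet z x) y) = 0"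
        by (simp add: prod_eq_iff zdet_def algebra_simps)
      moreover have "zscale (- zdet z y) x + zscale (zdet z x) y \<in> step_sums X"
        using that x
        by (intro add_in_step_sums zscale_in_step_sums step_in_step_sums) auto
      ultimately show False
        using nz uminus_in_step_sums[OF step_in_step_sums[OF z]] neg by (metis not_le)
    qed
    \<comment> \<open>Dividing this identity by the negative number
      \<open>zdet z x * zdet z y\<close> gives the difference of the cotangents.\<close>
    moreover have "zdot z x * zdet z y - zdet z x * zdot z y = zdot z z * zdet x y"
      by (simp add: zdot_def zdet_def algebra_simps)
    ultimately have "zdot z x * zdet z y \<le> zdet z x * zdot z y"
      using zz by (smt (verit) mult_nonneg_nonpos)
    then have "real_of_int (zdot z x) * real_of_int (zdet z y)
        \<le> real_of_int (zdet z x) * real_of_int (zdot z y)"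
      by (simp flip: of_int_mult)
    then show ?thesis
      using x that(3) by (simp add: cot_def field_simps)
  qed
  define c where "c = Inf (cot ` U)"
  have bdd: "bdd_below (cot ` U)"
    using right_ne sep by (meson bdd_belowI2)
  have c_left: "c \<le> cot x" if "x \<in> U" for x
    unfolding c_def using bdd that by (simp add: cINF_lower)
  have c_right: "cot y \<le> c" if "y \<in> X" "zdet z y < 0" for y
    unfolding c_def using left_ne sep that by (simp add: cINF_greatest)
  \<comment> \<open>\<open>z\<close> minus \<open>c\<close> times its counterclockwise quarter turn.
    Nonnegativity of the inner product with \<open>p\<close> then compares \<open>cot p\<close> with
    \<open>c\<close>, in the direction given by the side of \<open>p\<close>.\<close>
  define a where "a = (fst z + c * snd z, snd z - c * fst z)"
  have a: "a \<bullet> plane_point p = zdot z p - c * zdet z p" for p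
    by (simp add: inner_plane_point a_def zdot_def zdet_def algebra_simps)
  have "a \<bullet> plane_point z > 0"
    using zz by (simp add: a) (simp add: zdet_def)
  then have "a \<noteq> 0" by auto
  moreover have "a \<bullet> plane_point x \<ge> 0" if x: "x \<in> X" for x
  proof -
    consider "zdet z x > 0" | "zdet z x < 0" | "zdet z x = 0" by linarith
    then show ?thesis
    proof cases
      case 1
      then have "c \<le> cot x" using c_left x by (simp add: U_def)
      then show ?thesis using 1 by (simp add: a cot_def field_simps)
    next
      case 2
      then have "cot x \<le> c" using c_right x by simp
      then show ?thesis using 2 by (simp add: a cot_def field_simps)
    next
      case 3
      \<comment> \<open>A step on the line through \<open>z\<close> but opposite to it would produce
        \<open>-z\<close> directly.\<close>
      have "zdot z x \<ge> 0"
      proof (rule ccontr)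
        assume neg: "\<not> ?thesis"
        have "zscale (- zdot z x) z + zscale (zdot z z) x = 0"
          using zscale_zdot_collinear[OF 3] by (simp add: zero_prod_def)
        moreover have "zscale (zdot z z) x \<in> step_sums X"
          using x zz step_in_step_sums zscale_in_step_sums by simp
        ultimately show False
          using nz uminus_in_step_sums[OF step_in_step_sums[OF z]] neg
          by (metis neg_0_less_iff_less not_le)
      qed
      then show ?thesis using 3 by (simp add: a)
    qed
  qed
  ultimately show False using assms(2) WLC_iff by blast
qed

section \<open>Isomorphism types\<close>

text \<open>The least positive element divides all others, since a remainder modulo it lies in
  \<open>S\<close> and is smaller.\<close>

lemma int_subgroup_generator:
  fixes S :: "int set"
  assumes "s \<in> S" "s \<noteq> 0" and diff: "\<And>x y. x \<in> S \<Longrightarrow> y \<in> S \<Longrightarrow> x - y \<in> S"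
  shows "\<exists>d>0. d \<in> S \<and> (\<forall>x\<in>S. d dvd x)"
proof -
  have z: "0 \<in> S" using diff[OF assms(1,1)] by simp
  have n: "- x \<in> S" if "x \<in> S" for x using diff[OF z that] by simp
  have add: "x + y \<in> S" if "x \<in> S" "y \<in> S" for x y
    using diff[OF that(1) n[OF that(2)]] by simp
  have "\<bar>s\<bar> \<in> S" using assms(1) n by (simp add: abs_if)
  then have ex: "\<exists>m. m > 0 \<and> int m \<in> S"
    using assms(2) by (intro exI[of _ "nat \<bar>s\<bar>"]) auto
  define m where "m = (LEAST m. m > 0 \<and> int m \<in> S)"
  have m: "m > 0" "int m \<in> S"
    using LeastI_ex[OF ex] by (auto simp: m_def)
  have mult: "int k * int m \<in> S" for k
    by (induction k) (auto simp: z algebra_simps intro: add m)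
  have mult': "k * int m \<in> S" for k
    using mult[of "nat k"] n[OF mult[of "nat (- k)"]] by (cases "k \<ge> 0") auto
  have "int m dvd x" if "x \<in> S" for x
  proof (rule ccontr)
    assume nd: "\<not> ?thesis"
    define r where "r = x mod int m"
    have "r = x - (x div int m) * int m"
      by (simp add: r_def minus_div_mult_eq_mod)
    then have "r \<in> S" using diff[OF that mult'] by simp
    moreover have "r \<noteq> 0" "r \<ge> 0" "r < int m"
      using nd m(1) unfolding r_def by (auto intro: dvdI simp: mod_0_imp_dvd)
    ultimately have "nat r > 0 \<and> int (nat r) \<in> S" "nat r < m" by auto
    then show False using not_less_Least[of "nat r"] unfolding m_def by blast
  qed
  then show ?thesis using m by (intro exI[of _ "int m"]) simp
qed

lemma diff_in_step_group:
  assumes "group (step_monoid X)" "x \<in> step_sums X" "y \<in> step_sums X"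
  shows "x - y \<in> step_sums X"
  using add_in_step_sums[OF assms(2) group_step_monoidD[OF assms(1,3)]] by simp

text \<open>An additive map with trivial kernel embeds the group into the integers. Its image
  consists of the multiples of some \<open>d\<close>, and a preimage \<open>g\<close> of
  \<open>d\<close> generates the group freely.\<close>

lemma iso_integer_group_if_inj:
  fixes f :: "int \<times> int \<Rightarrow> int"
  assumes G: "group (step_monoid X)" and add: "\<And>x y. f (x + y) = f x + f y"
    and inj: "\<And>x. x \<in> step_sums X \<Longrightarrow> f x = 0 \<Longrightarrow> x = 0"
    and x: "x \<in> step_sums X" "x \<noteq> 0"
  shows "step_monoid X \<cong> integer_group"
proof -
  have diff: "f (x - y) = f x - f y" for x y
    using add[of "x - y" y] by simp
  obtain d where d: "d > 0" "d \<in> f ` step_sums X" "\<And>y. y \<in> f ` step_sums X \<Longrightarrow> d dvd y"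
  proof -
    have "f x \<in> f ` step_sums X" "f x \<noteq> 0" using x inj[OF x(1)] by auto
    moreover have "u - v \<in> f ` step_sums X"
      if "u \<in> f ` step_sums X" "v \<in> f ` step_sums X" for u v
      using that diff_in_step_group[OF G] by (metis (no_types) diff imageE imageI)
    ultimately have "\<exists>d>0. d \<in> f ` step_sums X \<and> (\<forall>y\<in>f ` step_sums X. d dvd y)"
      by (rule int_subgroup_generator)
    then show ?thesis using that by blast
  qed
  obtain g where g: "g \<in> step_sums X" "f g = d" using d(2) by auto
  have scale: "f (zscale k g) = k * d" for k
  proof (induction k rule: int_induct[of _ 0])
    case base
    then show ?case using diff[of 0 0] by (simp add: zero_prod_def)
  next
    case (step1 i)
    have "zscale (i + 1) g = zscale i g + g" by (simp add: prod_eq_iff algebra_simps)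
    then have "f (zscale (i + 1) g) = i * d + d" by (simp only: add step1(2) g(2))
    then show ?case by (simp only: distrib_right mult_1)
  next
    case (step2 i)
    have "zscale (i - 1) g = zscale i g - g" by (simp add: prod_eq_iff algebra_simps)
    then have "f (zscale (i - 1) g) = i * d - d" by (simp only: diff step2(2) g(2))
    then show ?case by (simp only: left_diff_distrib mult_1)
  qed
  \<comment> \<open>The isomorphism is explicit in this direction; it is inverted at the
    end.\<close>
  have "(\<lambda>k. zscale k g) \<in> iso integer_group (step_monoid X)"
  proof (rule isoI)
    show "(\<lambda>k. zscale k g) \<in> hom integer_group (step_monoid X)"
      using zscale_in_step_group[OF G g(1)] by (auto simp: hom_def algebra_simps)
    show "bij_betw (\<lambda>k. zscale k g) (carrier integer_group) (step_sums X)"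
      unfolding bij_betw_def
    proof
      have "k = l" if "zscale k g = zscale l g" for k l
        using scale[of k] scale[of l] d(1) unfolding that by simp
      then show "inj_on (\<lambda>k. zscale k g) (carrier integer_group)" by (rule inj_onI)
      show "(\<lambda>k. zscale k g) ` carrier integer_group = step_sums X"
      proof
        show "step_sums X \<subseteq> (\<lambda>k. zscale k g) ` carrier integer_group"
        proof
          fix y assume y: "y \<in> step_sums X"
          then obtain k where "f y = d * k" using d(3) by blast
          then have "f (y - zscale k g) = 0" by (simp only: diff scale) simp
          then have "y = zscale k g"
            using inj diff_in_step_group[OF G y zscale_in_step_group[OF G g(1)]]
            by (metis eq_iff_diff_eq_0)
          then show "y \<in> (\<lambda>k. zscale k g) ` carrier integer_group" by auto
        qed
      qed (use zscale_in_step_group[OF G g(1)] in auto)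
    qed
  qed
  then show ?thesis
    using group.iso_sym[OF group_integer_group] by (auto simp: is_iso_def)
qed

text \<open>The embedding into the integers is a coordinate projection, for a coordinate in which a
  chosen step \<open>x\<close> is nonzero. Collinearity with \<open>x\<close> makes it
  injective.\<close>

lemma iso_integer_group_collinear:
  assumes "step_set X" "X \<noteq> {}" "\<And>x y. x \<in> X \<Longrightarrow> y \<in> X \<Longrightarrow> zdet x y = 0"
    "group (step_monoid X)"
  shows "step_monoid X \<cong> integer_group"
proof -
  obtain x where x: "x \<in> X" using assms(2) by auto
  then have "x \<noteq> 0" using assms(1) by (auto simp: step_set_def zero_prod_def)
  have det: "zdet x y = 0" if "y \<in> step_sums X" for y
    using that
  proof (induction rule: step_sums_induct)
    case (add u v)
    have "zdet x (u + v) = zdet x u + zdet x v" by (simp add: zdet_def algebra_simps)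
    then show ?case using add by simp
  qed (use x assms(3) in \<open>auto simp: zdet_def\<close>)
  show ?thesis
  proof (cases "fst x = 0")
    case True
    then have "snd x \<noteq> 0" using \<open>x \<noteq> 0\<close> by (simp add: prod_eq_iff)
    show ?thesis
      by (rule iso_integer_group_if_inj[OF assms(4), of snd x])
        (use det True \<open>snd x \<noteq> 0\<close> \<open>x \<noteq> 0\<close> step_in_step_sums[OF x]
          in \<open>auto simp: zdet_def prod_eq_iff\<close>)
  next
    case False
    show ?thesis
      by (rule iso_integer_group_if_inj[OF assms(4), of fst x])
        (use det[unfolded zdet_def] False \<open>x \<noteq> 0\<close> step_in_step_sums[OF x]
          in \<open>force simp: prod_eq_iff\<close>)+
  qed
qed

text \<open>A triangular lattice basis: \<open>(e, 0)\<close> generates the elements with second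
  coordinate 0, and \<open>g\<close> has the least positive second coordinate
  \<open>d\<close>.\<close>

lemma iso_Z2_group_if_zdet:
  assumes G: "group (step_monoid X)" and x: "x \<in> X" and y: "y \<in> X" and "zdet x y \<noteq> 0"
  shows "step_monoid X \<cong> Z2_group"
proof -
  note xA = step_in_step_sums[OF x] and yA = step_in_step_sums[OF y]
  have "snd x \<noteq> 0 \<or> snd y \<noteq> 0" using assms(4) by (auto simp: zdet_def)
  then obtain w where w: "w \<in> step_sums X" "snd w \<noteq> 0" using xA yA by blast
  obtain d where d: "d > 0" "d \<in> snd ` step_sums X" "\<And>t. t \<in> snd ` step_sums X \<Longrightarrow> d dvd t"
  proof -
    have "snd w \<in> snd ` step_sums X" using w(1) by auto
    moreover have "u - v \<in> snd ` step_sums X"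
      if "u \<in> snd ` step_sums X" "v \<in> snd ` step_sums X" for u v
      using that diff_in_step_group[OF G] by (metis (no_types) imageE imageI snd_diff)
    ultimately have "\<exists>d>0. d \<in> snd ` step_sums X \<and> (\<forall>t\<in>snd ` step_sums X. d dvd t)"
      by (rule int_subgroup_generator[OF _ w(2)])
    then show ?thesis using that by blast
  qed
  obtain e where e: "e > 0" "(e, 0) \<in> step_sums X" "\<And>t. (t, 0) \<in> step_sums X \<Longrightarrow> e dvd t"
  proof -
    let ?S = "{t. (t, 0) \<in> step_sums X}"
    \<comment> \<open>Eliminating the second coordinate shows that the horizontal part is
      nonzero.\<close>
    have "zscale (snd y) x - zscale (snd x) y = (zdet x y, 0)"
      by (simp add: zdet_def algebra_simps)
    then have "zdet x y \<in> ?S"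
      using diff_in_step_group[OF G zscale_in_step_group[OF G xA] zscale_in_step_group[OF G yA]]
      by (metis mem_Collect_eq)
    moreover have "u - v \<in> ?S" if "u \<in> ?S" "v \<in> ?S" for u v
      using that diff_in_step_group[OF G, of "(u, 0)" "(v, 0)"] by simp
    ultimately have "\<exists>e>0. e \<in> ?S \<and> (\<forall>t\<in>?S. e dvd t)"
      by (rule int_subgroup_generator[OF _ assms(4)])
    then show ?thesis using that by blast
  qed
  obtain g where g: "g \<in> step_sums X" "snd g = d" using d(2) by auto
  define h where "h = (\<lambda>(m, n). zscale m (e, 0) + zscale n g)"
  have h_in: "h p \<in> step_sums X" for p
    unfolding h_def case_prod_beta
    by (intro add_in_step_sums zscale_in_step_group G e g)
  have "h \<in> iso Z2_group (step_monoid X)"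
  proof (rule isoI)
    show "h \<in> hom Z2_group (step_monoid X)"
      using h_in by (auto simp: hom_def) (auto simp: h_def algebra_simps)
    show "bij_betw h (carrier Z2_group) (step_sums X)"
      unfolding bij_betw_def
    proof
      show "inj_on h (carrier Z2_group)"
        using d(1) e(1) g(2) by (auto simp: inj_on_def h_def)
      show "h ` carrier Z2_group = step_sums X"
      proof
        show "step_sums X \<subseteq> h ` carrier Z2_group"
        proof
          fix p assume p: "p \<in> step_sums X"
          then obtain n where n: "snd p = d * n" using d(3) by blast
          \<comment> \<open>Subtracting the right multiple of \<open>g\<close> clears the second
            coordinate and leaves a multiple of \<open>(e, 0)\<close>.\<close>
          have "p - zscale n g = (fst p - n * fst g, 0)"
            using n g(2) by (simp add: prod_eq_iff)
          then have "(fst p - n * fst g, 0) \<in> step_sums X"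
            using diff_in_step_group[OF G p zscale_in_step_group[OF G g(1)]] by metis
          then obtain m where "fst p - n * fst g = e * m" using e(3) by blast
          then have "p = h (m, n)"
            using n g(2) by (simp add: h_def prod_eq_iff algebra_simps)
          then show "p \<in> h ` carrier Z2_group" by auto
        qed
      qed (use h_in in auto)
    qed
  qed
  then show ?thesis
    using group.iso_sym[OF DirProd_group[OF group_integer_group group_integer_group]]
    by (auto simp: is_iso_def)
qed

theorem theorem2p31:
  fixes X :: "(int \<times> int) set"
  assumes "step_set X"
  shows
    "(X = {} \<longrightarrow> trivial_group (step_monoid X)) \<and>
     (\<forall>L. X \<noteq> {} \<and> line_through_origin L \<and> plane_point ` X \<subseteq> L \<longrightarrow>
        (group (step_monoid X) \<longleftrightarrow> both_sides_of_origin X L) \<and>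
        (group (step_monoid X) \<longrightarrow> step_monoid X \<cong> integer_group)) \<and>
     (\<not> (\<exists>L. line_through_origin L \<and> plane_point ` X \<subseteq> L) \<longrightarrow>
        (group (step_monoid X) \<longleftrightarrow> \<not> WLC X) \<and>
        (group (step_monoid X) \<longrightarrow> step_monoid X \<cong> Z2_group))"
proof (intro conjI allI impI; (elim conjE)?)
  assume "X = {}"
  then show "trivial_group (step_monoid X)" using trivial_group_step_monoid_empty by simp
next
  fix L assume L: "X \<noteq> {}" "line_through_origin L" "plane_point ` X \<subseteq> L"
  have det: "zdet x y = 0" if "x \<in> X" "y \<in> X" for x y
    using zdet_on_line[OF L(2)] L(3) that by blast
  show "group (step_monoid X) \<longleftrightarrow> both_sides_of_origin X L"
    using group_collinear_iff[OF assms L(1) det] both_sides_iff[OF assms L(2,3)] by blast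
  show "step_monoid X \<cong> integer_group" if "group (step_monoid X)"
    using iso_integer_group_collinear[OF assms L(1) det that] .
next
  assume nl: "\<not> (\<exists>L. line_through_origin L \<and> plane_point ` X \<subseteq> L)"
  show "group (step_monoid X) \<longleftrightarrow> \<not> WLC X"
    using group_imp_not_WLC[OF _ nl] not_WLC_imp_group[OF assms] by blast
  show "step_monoid X \<cong> Z2_group" if "group (step_monoid X)"
    using exists_zdet_nonzero[OF assms nl] iso_Z2_group_if_zdet[OF that] by metis
qed

end
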